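(* Let $k\ge1$ and let $(a,b)\in P_+^k\setminus\mathcal{J}_3$. Let $(i,j),(m,n)\in\mathcal{R}^{(1);k}_{(a,b),(b,a)}$ with $(i,j)\notin\mathcal{J}_3$ and $(m,n)\notin\mathcal{J}_3$. Then $$\dim\operatorname{Hom}\big((a,b)\times(b,a)\times(i,j)\times(m,n),(0,0)\big)>1 .$$
   Context: $\widehat{\mathfrak{su}}(3)_k$ fusion. Fix an integer $k\ge1$ and let $P_+^k=\{(\lambda_1,\lambda_2)\in\mathbb{Z}_{\ge0}^2:\lambda_1+\lambda_2\le k\}$. The conjugate of $(x,y)$ is $(y,x)$. For $\lambda,\mu,\nu\in P_+^k$ set - $\mathcal{A}=\tfrac13[2(\lambda_1+\mu_1+\nu_2)+\lambda_2+\mu_2+\nu_1]$, - $\mathcal{B}=\tfrac13[\lambda_1+\mu_1+\nu_2+2(\lambda_2+\mu_2+\nu_1)]$, - $k_0^{\max}=\min(\mathcal{A},\mathcal{B})$, - $k_0^{\min}=\max(\lambda_1+\lambda_2,\mu_1+\mu_2,\nu_1+\nu_2,\mathcal{A}-\lambda_1,\mathcal{A}-\mu_1,\mathcal{A}-\nu_2,\mathcal{B}-\lambda_2,\mathcal{B}-\mu_2,\mathcal{B}-\nu_1)$. The fusion multiplicity is $N^{(k)\nu}_{\lambda,\mu}=\min(k_0^{\max},k)-k_0^{\min}+1$ if $\mathcal{A},\mathcal{B}$ are nonnegative integers, $k_0^{\max}\ge k_0^{\min}$ and $k\ge k_0^{\min}$; otherwise $N^{(k)\nu}_{\lambda,\mu}=0$.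 The fusion ring is the free abelian group on $P_+^k$ with the commutative, associative product $\lambda\times\mu=\sum_\nu N^{(k)\nu}_{\lambda,\mu}\,\nu$ and unit $(0,0)$. For $x_1,\dots,x_n\in P_+^k$, $\dim\operatorname{Hom}(x_1\times\cdots\times x_n,(0,0))$ denotes the coefficient of $(0,0)$ in $x_1\times\cdots\times x_n$. Further notation: - $\mathcal{R}^k_{\lambda,\mu}=\{\nu:N^{(k)\nu}_{\lambda,\mu}\ne0\}$; - $\mathcal{R}^{(1);k}_{\lambda,\mu}=\{\nu:N^{(k)\nu}_{\lambda,\mu}=1\}$; - the simple currents are $\mathcal{J}_3=\{(0,0),(k,0),(0,k)\}$. *)

theory Defs
  imports Complex_Main
begin

type_synonym weight = "nat \<times> nat"

definition Pplus :: "nat \<Rightarrow> weight set" where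
  "Pplus k = {(l1, l2). l1 + l2 \<le> k}"

definition conj_wt :: "weight \<Rightarrow> weight" where
  "conj_wt w = (snd w, fst w)"

definition simple_currents :: "nat \<Rightarrow> weight set" where
  "simple_currents k = {(0,0), (k,0), (0,k)}"

definition calA :: "weight \<Rightarrow> weight \<Rightarrow> weight \<Rightarrow> rat" where
  "calA l m n = (2 * of_nat (fst l + fst m + snd n) + of_nat (snd l + snd m + fst n)) / 3"

definition calB :: "weight \<Rightarrow> weight \<Rightarrow> weight \<Rightarrow> rat" where
  "calB l m n = (of_nat (fst l + fst m + snd n) + 2 * of_nat (snd l + snd m + fst n)) / 3"

definition k0max :: "weight \<Rightarrow> weight \<Rightarrow> weight \<Rightarrow> rat" where
  "k0max l m n = min (calA l m n) (calB l m n)"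

definition k0min :: "weight \<Rightarrow> weight \<Rightarrow> weight \<Rightarrow> rat" where
  "k0min l m n = Max {of_nat (fst l + snd l), of_nat (fst m + snd m), of_nat (fst n + snd n),
      calA l m n - of_nat (fst l), calA l m n - of_nat (fst m), calA l m n - of_nat (snd n),
      calB l m n - of_nat (snd l), calB l m n - of_nat (snd m), calB l m n - of_nat (fst n)}"

definition fusionN :: "nat \<Rightarrow> weight \<Rightarrow> weight \<Rightarrow> weight \<Rightarrow> nat" where
  "fusionN k l m n =
     (if calA l m n \<in> \<nat> \<and> calB l m n \<in> \<nat> \<and> k0max l m n \<ge> k0min l m n
         \<and> of_nat k \<ge> k0min l m n
      then nat \<lfloor>min (k0max l m n) (of_nat k) - k0min l m n + 1\<rfloor> else 0)"

definition R1 :: "nat \<Rightarrow> weight \<Rightarrow> weight \<Rightarrow> weight set" where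
  "R1 k l m = {n \<in> Pplus k. fusionN k l m n = 1}"

text \<open>Elements of the fusion ring: integer coefficient functions supported on P_+^k.\<close>
definition basis_el :: "weight \<Rightarrow> weight \<Rightarrow> int" where
  "basis_el w = (\<lambda>v. if v = w then 1 else 0)"

definition fusion_prod :: "nat \<Rightarrow> (weight \<Rightarrow> int) \<Rightarrow> (weight \<Rightarrow> int) \<Rightarrow> (weight \<Rightarrow> int)" where
  "fusion_prod k f g = (\<lambda>n. if n \<in> Pplus k then
      (\<Sum>l\<in>Pplus k. \<Sum>m\<in>Pplus k. f l * g m * int (fusionN k l m n)) else 0)"

definition fusion_list_prod :: "nat \<Rightarrow> weight list \<Rightarrow> (weight \<Rightarrow> int)" where
  "fusion_list_prod k xs = foldl (\<lambda>acc x. fusion_prod k acc (basis_el x)) (basis_el (0,0)) xs"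

definition dimHom0 :: "nat \<Rightarrow> weight list \<Rightarrow> int" where
  "dimHom0 k xs = fusion_list_prod k xs (0,0)"

end

theory Submission
  imports Defs
begin

text \<open>
  Put \<open>c = k - a - b\<close> and write weights in the root lattice as \<open>x \<alpha>\<^sub>1 + y \<alpha>\<^sub>2\<close>. The multiplicity of
  such a weight in \<open>(a,b) \<times> (b,a)\<close> is \<open>1 - \<bar>x - y\<bar> + D (min x y)\<close> for a concave piecewise linear \<open>D\<close>
  which is symmetric in \<open>a, b, c\<close>, so multiplicity one means \<open>\<bar>x - y\<bar> = D (min x y)\<close>. The
  dimension in question is at least the sum over \<open>\<nu>\<close> of the multiplicity of \<open>\<nu>\<close> in \<open>(a,b) \<times> (b,a)\<close>
  times that of the conjugate \<open>(n,m)\<close> in \<open>\<nu> \<times> (i,j)\<close>. Up to the symmetries, either two channels \<open>\<nu>\<close>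
  near the dominant representative of \<open>(n,m) - (i,j)\<close> contribute, or one contributes twice; the
  choice of channel is linear on each of finitely many regions.
\<close>

section \<open>Fusion multiplicities as integer inequalities\<close>

text \<open>A minimum minus a maximum plus one is at least \<open>t\<close> iff this holds for every
  pair of bounds; this replaces the rational formula by linear integer arithmetic. As
  \<open>t\<close> is positive, the default value 0 agrees with a failing inequality.\<close>

lemma fusionN_ge_iff:
  fixes A B :: int and t :: nat
  assumes A: "3 * A = int (2 * (fst l + fst m + snd n) + (snd l + snd m + fst n))"
    and B: "3 * B = int ((fst l + fst m + snd n) + 2 * (snd l + snd m + fst n))"
    and t: "t \<ge> 1"
  shows "t \<le> fusionN k l m n \<longleftrightarrow>
    (\<forall>lo\<in>{int (fst l + snd l), int (fst m + snd m), int (fst n + snd n),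
        A - int (fst l), A - int (fst m), A - int (snd n),
        B - int (snd l), B - int (snd m), B - int (fst n)}.
     \<forall>hi\<in>{A, B, int k}. lo + int t \<le> hi + 1)" (is "_ \<longleftrightarrow> ?R")
proof -
  have "rat_of_int (3 * A) = rat_of_nat (2 * (fst l + fst m + snd n) + (snd l + snd m + fst n))"
    unfolding A by simp
  then have cA: "calA l m n = of_int A"
    unfolding calA_def by simp
  have "rat_of_int (3 * B) = rat_of_nat ((fst l + fst m + snd n) + 2 * (snd l + snd m + fst n))"
    unfolding B by simp
  then have cB: "calB l m n = of_int B"
    unfolding calB_def by simp
  have "A \<ge> 0" "B \<ge> 0"
    using A B by linarith+
  then have nats: "calA l m n \<in> \<nat>" "calB l m n \<in> \<nat>"
    unfolding cA cB by (auto simp: Nats_altdef2)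
  have mx: "k0max l m n = of_int (min A B)"
    unfolding k0max_def cA cB by (simp add: min_def)
  have le: "k0min l m n \<le> of_int z \<longleftrightarrow>
    (\<forall>lo\<in>{int (fst l + snd l), int (fst m + snd m), int (fst n + snd n),
        A - int (fst l), A - int (fst m), A - int (snd n),
        B - int (snd l), B - int (snd m), B - int (fst n)}. lo \<le> z)" for z :: int
  proof -
    have "k0min l m n = Max (rat_of_int ` {int (fst l + snd l), int (fst m + snd m), int (fst n + snd n),
        A - int (fst l), A - int (fst m), A - int (snd n),
        B - int (snd l), B - int (snd m), B - int (fst n)})"
      unfolding k0min_def cA cB
      by (simp only: image_insert image_empty of_int_diff of_int_of_nat_eq)
    also have "\<dots> \<le> of_int z \<longleftrightarrow> (\<forall>r\<in>rat_of_int ` {int (fst l + snd l), int (fst m + snd m), int (fst n + snd n),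
        A - int (fst l), A - int (fst m), A - int (snd n),
        B - int (snd l), B - int (snd m), B - int (fst n)}. r \<le> of_int z)"
      by (rule Max_le_iff) auto
    finally show ?thesis
      unfolding ball_simps of_int_le_iff .
  qed
  let ?h = "min (min A B) (int k)"
  have R: "?R \<longleftrightarrow> k0min l m n \<le> of_int (?h + 1 - int t)"
  proof -
    have "(\<forall>hi\<in>{A, B, int k}. lo + int t \<le> hi + 1) \<longleftrightarrow> lo \<le> ?h + 1 - int t" for lo :: int
      by (simp only: ball_simps min_def) (auto split: if_splits)
    then show ?thesis
      unfolding le by presburger
  qed
  show ?thesis
  proof (cases "k0min l m n \<le> of_int ?h")
    case True
    then have "k0min l m n \<le> k0max l m n" "k0min l m n \<le> of_nat k"
      unfolding mx by (auto intro: order_trans)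
    then have "fusionN k l m n = nat \<lfloor>rat_of_int ?h - k0min l m n + 1\<rfloor>"
      using nats unfolding fusionN_def mx by (auto simp: min_def)
    then have "t \<le> fusionN k l m n \<longleftrightarrow> int t \<le> \<lfloor>rat_of_int ?h - k0min l m n + 1\<rfloor>"
      using t by linarith
    also have "\<dots> \<longleftrightarrow> of_nat t \<le> rat_of_int ?h - k0min l m n + 1"
      by (simp only: le_floor_iff of_int_of_nat_eq)
    also have "\<dots> \<longleftrightarrow> k0min l m n \<le> rat_of_int ?h + 1 - of_nat t"
      by linarith
    also have "rat_of_int ?h + 1 - of_nat t = of_int (?h + 1 - int t)"
      by (simp only: of_int_diff of_int_add of_int_1 of_int_of_nat_eq)
    finally show ?thesis
      unfolding R .
  next
    case False
    then have "\<not> (k0min l m n \<le> k0max l m n \<and> k0min l m n \<le> of_nat k)"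
      unfolding mx by (auto simp: min_def split: if_splits)
    then have "fusionN k l m n = 0"
      unfolding fusionN_def by auto
    moreover have "\<not> k0min l m n \<le> of_int (?h + 1 - int t)"
    proof
      assume "k0min l m n \<le> of_int (?h + 1 - int t)"
      also have "\<dots> \<le> rat_of_int ?h"
        using t by (subst of_int_le_iff) linarith
      finally show False
        using False by simp
    qed
    ultimately show ?thesis
      unfolding R using t by simp
  qed
qed

section \<open>Lower bounds in the fusion ring\<close>

lemma fusion_prod_ge:
  assumes f: "\<And>l. f l \<ge> 0" and g: "\<And>m. g m \<ge> 0"
    and T: "T \<subseteq> Pplus k" and m: "m \<in> Pplus k" and n: "n \<in> Pplus k"
  shows "(\<Sum>l\<in>T. f l * g m * int (fusionN k l m n)) \<le> fusion_prod k f g n"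
proof -
  have fin: "finite (Pplus k)"
    by (rule finite_subset[of _ "{..k} \<times> {..k}"]) (auto simp: Pplus_def)
  have "(\<Sum>l\<in>T. f l * g m * int (fusionN k l m n)) \<le> (\<Sum>l\<in>Pplus k. f l * g m * int (fusionN k l m n))"
    using f g fin T by (intro sum_mono2) auto
  also have "\<dots> \<le> (\<Sum>l\<in>Pplus k. \<Sum>m\<in>Pplus k. f l * g m * int (fusionN k l m n))"
    using f g fin m by (intro sum_mono member_le_sum) auto
  finally show ?thesis
    using n by (simp add: fusion_prod_def)
qed

lemma fusion_prod_nonneg:
  assumes "\<And>l. f l \<ge> 0" and "\<And>m. g m \<ge> 0"
  shows "fusion_prod k f g n \<ge> 0"
  using assms by (auto simp: fusion_prod_def intro!: sum_nonneg)

lemma fusionN_unit_left: "v \<in> Pplus k \<Longrightarrow> fusionN k (0,0) v v \<ge> 1"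
  by (subst fusionN_ge_iff[where A = "int (fst v + snd v)" and B = "int (fst v + snd v)"])
    (auto simp: Pplus_def)

lemma fusionN_conj: "v \<in> Pplus k \<Longrightarrow> fusionN k (conj_wt v) v (0,0) \<ge> 1"
  by (subst fusionN_ge_iff[where A = "int (fst v + snd v)" and B = "int (fst v + snd v)"])
    (auto simp: Pplus_def conj_wt_def)

text \<open>All coefficients are nonnegative, so it suffices to keep the paths from the unit through
  \<open>v1\<close>, some \<open>w\<close> in \<open>T\<close> and the conjugate of
  \<open>v4\<close> back to the unit. The first and last step of such a path have multiplicity at
  least one.\<close>

lemma dimHom0_ge:
  assumes T: "T \<subseteq> Pplus k" and P: "v1 \<in> Pplus k" "v2 \<in> Pplus k" "v3 \<in> Pplus k" "v4 \<in> Pplus k"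
  shows "(\<Sum>w\<in>T. int (fusionN k v1 v2 w) * int (fusionN k w v3 (conj_wt v4))) \<le> dimHom0 k [v1, v2, v3, v4]"
proof -
  define f1 where "f1 = fusion_prod k (basis_el (0,0)) (basis_el v1)"
  define f2 where "f2 = fusion_prod k f1 (basis_el v2)"
  define f3 where "f3 = fusion_prod k f2 (basis_el v3)"
  have b: "basis_el v w \<ge> 0" for v w
    by (simp add: basis_el_def)
  have b1: "basis_el v v = 1" for v
    by (simp add: basis_el_def)
  have n1: "f1 w \<ge> 0" for w unfolding f1_def by (intro fusion_prod_nonneg b)
  have n2: "f2 w \<ge> 0" for w unfolding f2_def by (intro fusion_prod_nonneg b n1)
  have n3: "f3 w \<ge> 0" for w unfolding f3_def by (intro fusion_prod_nonneg b n2)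
  have z: "(0,0) \<in> Pplus k" and c: "conj_wt v4 \<in> Pplus k"
    using P by (auto simp: Pplus_def conj_wt_def)
  have 1: "1 \<le> f1 v1"
  proof -
    have "int (fusionN k (0,0) v1 v1) \<le> f1 v1"
      using fusion_prod_ge[where f = "basis_el (0,0)" and g = "basis_el v1" and T = "{(0,0)}" and k = k
          and m = v1 and n = v1, OF b b] P z by (simp add: f1_def b1)
    then show ?thesis
      using fusionN_unit_left[OF P(1)] by linarith
  qed
  have 2: "int (fusionN k v1 v2 w) \<le> f2 w" if "w \<in> Pplus k" for w
  proof -
    have "f1 v1 * int (fusionN k v1 v2 w) \<le> f2 w"
      using fusion_prod_ge[where f = f1 and g = "basis_el v2" and T = "{v1}" and m = v2 and n = w, OF n1 b] P that by (simp add: f2_def b1)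
    moreover have "1 * int (fusionN k v1 v2 w) \<le> f1 v1 * int (fusionN k v1 v2 w)"
      using 1 by (intro mult_right_mono) auto
    ultimately show ?thesis by simp
  qed
  have "(\<Sum>w\<in>T. int (fusionN k v1 v2 w) * int (fusionN k w v3 (conj_wt v4)))
      \<le> (\<Sum>w\<in>T. f2 w * int (fusionN k w v3 (conj_wt v4)))"
    using 2 T by (intro sum_mono mult_right_mono) auto
  also have "\<dots> \<le> f3 (conj_wt v4)"
    using fusion_prod_ge[where f = f2 and g = "basis_el v3", OF n2 b T P(3) c] by (simp add: f3_def b1)
  also have "\<dots> \<le> f3 (conj_wt v4) * int (fusionN k (conj_wt v4) v4 (0,0))"
    using mult_left_mono[of 1 "int (fusionN k (conj_wt v4) v4 (0,0))" "f3 (conj_wt v4)"]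
      fusionN_conj[OF P(4)] n3 by simp
  also have "\<dots> \<le> fusion_prod k f3 (basis_el v4) (0,0)"
    using fusion_prod_ge[where f = f3 and g = "basis_el v4" and T = "{conj_wt v4}" and m = v4 and n = "(0,0)", OF n3 b] P c z by (simp add: b1)
  also have "\<dots> = dimHom0 k [v1, v2, v3, v4]"
    by (simp add: dimHom0_def fusion_list_prod_def f1_def f2_def f3_def)
  finally show ?thesis .
qed

section \<open>Root-lattice coordinates and channels\<close>

text \<open>The weight \<open>x \<alpha>\<^sub>1 + y \<alpha>\<^sub>2\<close> in Dynkin labels; both labels must be nonnegative, as \<open>nat\<close> truncates.\<close>
definition root_wt :: "int \<Rightarrow> int \<Rightarrow> weight" where
  "root_wt x y = (nat (2 * x - y), nat (2 * y - x))"

text \<open>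
  \<open>adj_ge\<close> and \<open>triple_ge\<close> say that a fusion multiplicity is at least \<open>t\<close>: of \<open>x \<alpha>\<^sub>1 + y \<alpha>\<^sub>2\<close> in
  \<open>(a,b) \<times> (b,a)\<close> at level \<open>a + b + c\<close>, and of the third root-lattice weight in the product of the
  first two at level \<open>k\<close>. They are only meaningful for \<open>t \<ge> 1\<close>.
\<close>
definition adj_ge :: "int \<Rightarrow> int \<Rightarrow> int \<Rightarrow> int \<Rightarrow> int \<Rightarrow> int \<Rightarrow> bool" where
  "adj_ge a b c t x y \<longleftrightarrow> (\<forall>hi\<in>{min x y, a + b + c - 2 * min x y, a, b, c,
     a + b - min x y, a + c - min x y, b + c - min x y}. \<bar>x - y\<bar> + t \<le> hi + 1)"

definition triple_ge :: "int \<Rightarrow> int \<Rightarrow> int \<Rightarrow> int \<Rightarrow> int \<Rightarrow> int \<Rightarrow> int \<Rightarrow> int \<Rightarrow> bool" where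
  "triple_ge k t x y x' y' x'' y'' \<longleftrightarrow>
    (\<forall>hi\<in>{x + x' + y'', y + y' + x'', k}.
     \<forall>lo\<in>{x + y, x' + y', x'' + y'',
       x' + y'' - x + y, x + y'' - x' + y', x + x' - y'' + x'',
       y' + x'' - y + x, y + x'' - y' + x', y + y' - x'' + y''}. lo + t \<le> hi + 1)"

text \<open>Each disjunct guarantees a contribution of at least two to the dimension. The last pair
  of coordinates is the target, the conjugate of the fourth factor. Dominance of the channels is
  implied by \<open>adj_ge\<close>.\<close>

definition two_channels :: "int \<Rightarrow> int \<Rightarrow> int \<Rightarrow> int \<Rightarrow> int \<Rightarrow> int \<Rightarrow> int \<Rightarrow> bool" where
  "two_channels a b c x' y' x'' y'' \<longleftrightarrow>
    (\<exists>x y. adj_ge a b c 2 x y \<and> triple_ge (a + b + c) 1 x y x' y' x'' y'') \<or>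
    (\<exists>x y z w. (x, y) \<noteq> (z, w) \<and>
      adj_ge a b c 1 x y \<and> triple_ge (a + b + c) 1 x y x' y' x'' y'' \<and>
      adj_ge a b c 1 z w \<and> triple_ge (a + b + c) 1 z w x' y' x'' y'')"

lemma two_channelsI_distinct:
  assumes "(x, y) \<noteq> (z, w)"
    and "adj_ge a b c 1 x y" "triple_ge (a + b + c) 1 x y x' y' x'' y''"
    and "adj_ge a b c 1 z w" "triple_ge (a + b + c) 1 z w x' y' x'' y''"
  shows "two_channels a b c x' y' x'' y''"
  using assms unfolding two_channels_def by blast

lemma two_channelsI_double:
  assumes "adj_ge a b c 2 x y" "triple_ge (a + b + c) 1 x y x' y' x'' y''"
  shows "two_channels a b c x' y' x'' y''"
  using assms unfolding two_channels_def by blast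

text \<open>
  For \<open>b \<le> a \<le> c\<close>: the weights \<open>q \<alpha>\<^sub>1 + (q + d) \<alpha>\<^sub>2\<close> of multiplicity one that are not simple
  currents. Equality \<open>d = q\<close>, \<open>2 * q + d = a + b + c\<close> would give the simple current \<open>(0,k)\<close>.
\<close>
definition boundary :: "int \<Rightarrow> int \<Rightarrow> int \<Rightarrow> int \<Rightarrow> int \<Rightarrow> bool" where
  "boundary a b c q d \<longleftrightarrow> 0 \<le> d \<and> 0 < q \<and>
     d \<le> b \<and> d \<le> q \<and> d \<le> a + b - q \<and> d \<le> a + b + c - 2 * q \<and>
     (d < q \<or> 2 * q + d < a + b + c) \<and>
     (d = b \<or> d = q \<or> d = a + b - q \<or> d = a + b + c - 2 * q)"

lemma boundaryD:
  assumes "boundary a b c q d"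
  shows "0 \<le> d" "0 < q" "d \<le> b" "d \<le> q" "d \<le> a + b - q" "d \<le> a + b + c - 2 * q"
     "d < q \<or> 2 * q + d < a + b + c"
     "d = b \<or> d = q \<or> d = a + b - q \<or> d = a + b + c - 2 * q"
  using assms unfolding boundary_def by blast+

text \<open>Under \<open>b \<le> a \<le> c\<close> every other bound in \<open>adj_ge\<close> is at
  least \<open>b\<close> or \<open>a + b - q\<close>.\<close>

lemma adj_geI:
  fixes a b c q d t :: int
  assumes "b \<le> a" "a \<le> c" "0 \<le> d"
    and "d + t \<le> b + 1" "d + t \<le> q + 1" "d + t \<le> a + b - q + 1" "d + t \<le> a + b + c - 2 * q + 1"
  shows "adj_ge a b c t q (q + d)" "adj_ge a b c t (q + d) q"
  using assms unfolding adj_ge_def ball_simps by simp_all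

text \<open>One premise for each of the 27 pairs of bounds, so that a channel check splits into
  single linear goals.\<close>

lemma triple_geI:
  fixes k t x y x' y' x'' y'' :: int
  assumes "x + y + t \<le> x + x' + y'' + 1" "x' + y' + t \<le> x + x' + y'' + 1" "x'' + y'' + t \<le> x + x' + y'' + 1"
    and "x' + y'' - x + y + t \<le> x + x' + y'' + 1" "x + y'' - x' + y' + t \<le> x + x' + y'' + 1" "x + x' - y'' + x'' + t \<le> x + x' + y'' + 1"
    and "y' + x'' - y + x + t \<le> x + x' + y'' + 1" "y + x'' - y' + x' + t \<le> x + x' + y'' + 1" "y + y' - x'' + y'' + t \<le> x + x' + y'' + 1"
    and "x + y + t \<le> y + y' + x'' + 1" "x' + y' + t \<le> y + y' + x'' + 1" "x'' + y'' + t \<le> y + y' + x'' + 1"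
    and "x' + y'' - x + y + t \<le> y + y' + x'' + 1" "x + y'' - x' + y' + t \<le> y + y' + x'' + 1" "x + x' - y'' + x'' + t \<le> y + y' + x'' + 1"
    and "y' + x'' - y + x + t \<le> y + y' + x'' + 1" "y + x'' - y' + x' + t \<le> y + y' + x'' + 1" "y + y' - x'' + y'' + t \<le> y + y' + x'' + 1"
    and "x + y + t \<le> k + 1" "x' + y' + t \<le> k + 1" "x'' + y'' + t \<le> k + 1"
    and "x' + y'' - x + y + t \<le> k + 1" "x + y'' - x' + y' + t \<le> k + 1" "x + x' - y'' + x'' + t \<le> k + 1"
    and "y' + x'' - y + x + t \<le> k + 1" "y + x'' - y' + x' + t \<le> k + 1" "y + y' - x'' + y'' + t \<le> k + 1"
  shows "triple_ge k t x y x' y' x'' y''"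
  using assms unfolding triple_ge_def ball_simps by blast

section \<open>Channels for each region of boundary weights\<close>

text \<open>
  Below, \<open>q \<alpha>\<^sub>1 + (q + d) \<alpha>\<^sub>2\<close> is \<open>(i,j)\<close> and the target is \<open>(n,m)\<close>; the channels were found by a
  search over small levels.
\<close>

lemma same_up_distinct:
  fixes a b c q d u e :: int
  assumes "0 \<le> b" "b \<le> a" "a \<le> c" "0 < a" "q \<le> u" "d \<le> e" "2 * u - q + e + d < a + b + c"
    and d: "boundary a b c q d" and e: "boundary a b c u e"
  shows "two_channels a b c q (q + d) u (u + e)"
proof -
  note h = assms(1-7) boundaryD[OF d] boundaryD[OF e]
  \<comment> \<open>The target minus \<open>(i,j)\<close>. It is dominant: \<open>d\<close> and
    \<open>e\<close> are the values at \<open>q\<close> and \<open>u\<close> of one minimum of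
    linear functions with slopes between -2 and 1, so \<open>e - d \<le> u - q\<close>.\<close>
  have "adj_ge a b c 1 (u - q) (u - q + (e - d))"
    by (rule adj_geI; use h in \<open>smt (z3)\<close>)
  moreover have "triple_ge (a + b + c) 1 (u - q) (u - q + (e - d)) q (q + d) u (u + e)"
    by (rule triple_geI; use h in \<open>smt (z3)\<close>)
  \<comment> \<open>Adding the highest root, with coordinates \<open>(1, 1)\<close>, is admissible
    at this level because \<open>2 * u - q + e + d < a + b + c\<close>.\<close>
  moreover have "adj_ge a b c 1 (u - q + 1) (u - q + 1 + (e - d))"
    by (rule adj_geI; use h in \<open>smt (z3)\<close>)
  moreover have "triple_ge (a + b + c) 1 (u - q + 1) (u - q + 1 + (e - d)) q (q + d) u (u + e)"
    by (rule triple_geI; use h in \<open>smt (z3)\<close>)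
  ultimately show ?thesis
    by (rule two_channelsI_distinct[rotated]) (use h in auto)
qed

text \<open>The level now forbids adding the highest root, but the difference itself has
  multiplicity two.\<close>

lemma same_up_double:
  fixes a b c q d u e :: int
  assumes "0 \<le> b" "b \<le> a" "a \<le> c" "0 < a" "q \<le> u" "d \<le> e" "a + b + c \<le> 2 * u - q + e + d"
    and d: "boundary a b c q d" and e: "boundary a b c u e"
  shows "two_channels a b c q (q + d) u (u + e)"
proof -
  note h = assms(1-7) boundaryD[OF d] boundaryD[OF e]
  have "adj_ge a b c 2 (u - q) (u - q + (e - d))"
    by (rule adj_geI; use h in \<open>smt (z3)\<close>)
  moreover have "triple_ge (a + b + c) 1 (u - q) (u - q + (e - d)) q (q + d) u (u + e)"
    by (rule triple_geI; use h in \<open>smt (z3)\<close>)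
  ultimately show ?thesis
    by (rule two_channelsI_double)
qed

text \<open>Channels are sought among \<open>(u - q, y)\<close>, the line through the difference in
  the direction of the second simple root. Fusion requires \<open>d - e \<le> y\<close> there, which
  \<open>y = u - q\<close> satisfies in this region.\<close>

lemma same_down_near:
  fixes a b c q d u e :: int
  assumes "0 \<le> b" "b \<le> a" "a \<le> c" "0 < a" "q \<le> u" "e < d" "d - e \<le> u - q"
    and d: "boundary a b c q d" and e: "boundary a b c u e"
  shows "two_channels a b c q (q + d) u (u + e)"
proof -
  note h = assms(1-7) boundaryD[OF d] boundaryD[OF e]
  have "adj_ge a b c 1 (u - q) (u - q + 0)"
    by (rule adj_geI; use h in \<open>smt (z3)\<close>)
  moreover have "triple_ge (a + b + c) 1 (u - q) (u - q + 0) q (q + d) u (u + e)"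
    by (rule triple_geI; use h in \<open>smt (z3)\<close>)
  moreover have "adj_ge a b c 1 (u - q) (u - q + 1)"
    by (rule adj_geI; use h in \<open>smt (z3)\<close>)
  moreover have "triple_ge (a + b + c) 1 (u - q) (u - q + 1) q (q + d) u (u + e)"
    by (rule triple_geI; use h in \<open>smt (z3)\<close>)
  ultimately show ?thesis
    by (rule two_channelsI_distinct[rotated]) (use h in auto)
qed

text \<open>On the same line fusion requires \<open>d - e \<le> y\<close> and dominance
  \<open>y \<le> 2 * (u - q)\<close>; the channels are these two endpoints.\<close>

lemma same_down_far1:
  fixes a b c q d u e :: int
  assumes "0 \<le> b" "b \<le> a" "a \<le> c" "0 < a" "q \<le> u" "e < d" "u - q < d - e" "d - e < 2 * (u - q)"
    and d: "boundary a b c q d" and e: "boundary a b c u e"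
  shows "two_channels a b c q (q + d) u (u + e)"
proof -
  note h = assms(1-8) boundaryD[OF d] boundaryD[OF e]
  have "adj_ge a b c 1 (u - q) (u - q + (d - e - (u - q)))"
    by (rule adj_geI; use h in \<open>smt (z3)\<close>)
  moreover have "triple_ge (a + b + c) 1 (u - q) (u - q + (d - e - (u - q))) q (q + d) u (u + e)"
    by (rule triple_geI; use h in \<open>smt (z3)\<close>)
  moreover have "adj_ge a b c 1 (u - q) (u - q + (u - q))"
    by (rule adj_geI; use h in \<open>smt (z3)\<close>)
  moreover have "triple_ge (a + b + c) 1 (u - q) (u - q + (u - q)) q (q + d) u (u + e)"
    by (rule triple_geI; use h in \<open>smt (z3)\<close>)
  ultimately show ?thesis
    by (rule two_channelsI_distinct[rotated]) (use h in auto)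
qed

text \<open>Slopes are at least -2, so \<open>d - e = 2 * (u - q)\<close> and the two endpoints
  coincide; the second channel adds the highest root.\<close>

lemma same_down_far2:
  fixes a b c q d u e :: int
  assumes "0 \<le> b" "b \<le> a" "a \<le> c" "0 < a" "q \<le> u" "e < d" "2 * (u - q) \<le> d - e"
    and d: "boundary a b c q d" and e: "boundary a b c u e"
  shows "two_channels a b c q (q + d) u (u + e)"
proof -
  note h = assms(1-7) boundaryD[OF d] boundaryD[OF e]
  have "adj_ge a b c 1 (u - q) (u - q + (d - e - (u - q)))"
    by (rule adj_geI; use h in \<open>smt (z3)\<close>)
  moreover have "triple_ge (a + b + c) 1 (u - q) (u - q + (d - e - (u - q))) q (q + d) u (u + e)"
    by (rule triple_geI; use h in \<open>smt (z3)\<close>)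
  moreover have "adj_ge a b c 1 (u - q + 1) (u - q + 1 + (d - e - (u - q)))"
    by (rule adj_geI; use h in \<open>smt (z3)\<close>)
  moreover have "triple_ge (a + b + c) 1 (u - q + 1) (u - q + 1 + (d - e - (u - q))) q (q + d) u (u + e)"
    by (rule triple_geI; use h in \<open>smt (z3)\<close>)
  ultimately show ?thesis
    by (rule two_channelsI_distinct[rotated]) (use h in auto)
qed

text \<open>The difference is \<open>(u - q + e, u - q - d)\<close>. The channels lie on its line
  \<open>(u - q + e, y)\<close>, where fusion requires \<open>d + e \<le> y\<close>.\<close>

lemma opposite_far:
  fixes a b c q d u e :: int
  assumes "0 \<le> b" "b \<le> a" "a \<le> c" "0 < a" "q \<le> u" "0 < d" "0 < e" "e + 2 * d < u - q"
    and d: "boundary a b c q d" and e: "boundary a b c u e"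
  shows "two_channels a b c q (q + d) (u + e) u"
proof -
  note h = assms(1-8) boundaryD[OF d] boundaryD[OF e]
  have "adj_ge a b c 1 (u - q + e) (u - q)"
    by (rule adj_geI; use h in \<open>smt (z3)\<close>)
  moreover have "triple_ge (a + b + c) 1 (u - q + e) (u - q) q (q + d) (u + e) u"
    by (rule triple_geI; use h in \<open>smt (z3)\<close>)
  moreover have "adj_ge a b c 1 (u - q + 1 + (e - 1)) (u - q + 1)"
    by (rule adj_geI; use h in \<open>smt (z3)\<close>)
  moreover have "triple_ge (a + b + c) 1 (u - q + 1 + (e - 1)) (u - q + 1) q (q + d) (u + e) u"
    by (rule triple_geI; use h in \<open>smt (z3)\<close>)
  ultimately show ?thesis
    by (rule two_channelsI_distinct[rotated]) (use h in auto)
qed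

text \<open>The endpoint \<open>y = d + e\<close> is the reflection of the difference in the second
  simple root, here its dominant representative.\<close>

lemma opposite_middle1:
  fixes a b c q d u e :: int
  assumes "0 \<le> b" "b \<le> a" "a \<le> c" "0 < a" "q \<le> u" "0 < d" "0 < e" "d < u - q" "u - q \<le> e + 2 * d" "u - q < d + e"
    and d: "boundary a b c q d" and e: "boundary a b c u e"
  shows "two_channels a b c q (q + d) (u + e) u"
proof -
  note h = assms(1-10) boundaryD[OF d] boundaryD[OF e]
  have "adj_ge a b c 2 (d + e + (u - q - d)) (d + e)"
    by (rule adj_geI; use h in \<open>smt (z3)\<close>)
  moreover have "triple_ge (a + b + c) 1 (d + e + (u - q - d)) (d + e) q (q + d) (u + e) u"
    by (rule triple_geI; use h in \<open>smt (z3)\<close>)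
  ultimately show ?thesis
    by (rule two_channelsI_double)
qed

lemma opposite_middle2:
  fixes a b c q d u e :: int
  assumes "0 \<le> b" "b \<le> a" "a \<le> c" "0 < a" "q \<le> u" "0 < d" "0 < e" "d < u - q" "u - q \<le> e + 2 * d" "d + e \<le> u - q"
    and d: "boundary a b c q d" and e: "boundary a b c u e"
  shows "two_channels a b c q (q + d) (u + e) u"
proof -
  note h = assms(1-10) boundaryD[OF d] boundaryD[OF e]
  have "adj_ge a b c 2 (u - q + 1 + (e - 1)) (u - q + 1)"
    by (rule adj_geI; use h in \<open>smt (z3)\<close>)
  moreover have "triple_ge (a + b + c) 1 (u - q + 1 + (e - 1)) (u - q + 1) q (q + d) (u + e) u"
    by (rule triple_geI; use h in \<open>smt (z3)\<close>)
  ultimately show ?thesis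
    by (rule two_channelsI_double)
qed

lemma opposite_near1:
  fixes a b c q d u e :: int
  assumes "0 \<le> b" "b \<le> a" "a \<le> c" "0 < a" "q \<le> u" "0 < d" "0 < e" "u - q \<le> d" "d < 2 * (u - q) + e"
    and d: "boundary a b c q d" and e: "boundary a b c u e"
  shows "two_channels a b c q (q + d) (u + e) u"
proof -
  note h = assms(1-9) boundaryD[OF d] boundaryD[OF e]
  have "adj_ge a b c 2 (u - q + e) (u - q + e + (d - (u - q)))"
    by (rule adj_geI; use h in \<open>smt (z3)\<close>)
  moreover have "triple_ge (a + b + c) 1 (u - q + e) (u - q + e + (d - (u - q))) q (q + d) (u + e) u"
    by (rule triple_geI; use h in \<open>smt (z3)\<close>)
  ultimately show ?thesis
    by (rule two_channelsI_double)
qed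

text \<open>Again slopes of at least -2 force \<open>d = 2 * (u - q) + e\<close>, so the reflected
  difference lies on a wall of the dominant chamber and the highest root is added to it.\<close>

lemma opposite_near2:
  fixes a b c q d u e :: int
  assumes "0 \<le> b" "b \<le> a" "a \<le> c" "0 < a" "q \<le> u" "0 < d" "0 < e" "q < u" "2 * (u - q) + e \<le> d"
    and d: "boundary a b c q d" and e: "boundary a b c u e"
  shows "two_channels a b c q (q + d) (u + e) u"
proof -
  note h = assms(1-9) boundaryD[OF d] boundaryD[OF e]
  have "adj_ge a b c 1 (u - q + e) (u - q + e + (d - (u - q)))"
    by (rule adj_geI; use h in \<open>smt (z3)\<close>)
  moreover have "triple_ge (a + b + c) 1 (u - q + e) (u - q + e + (d - (u - q))) q (q + d) (u + e) u"
    by (rule triple_geI; use h in \<open>smt (z3)\<close>)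
  moreover have "adj_ge a b c 1 (u - q + e + 1) (u - q + e + 1 + (d - (u - q)))"
    by (rule adj_geI; use h in \<open>smt (z3)\<close>)
  moreover have "triple_ge (a + b + c) 1 (u - q + e + 1) (u - q + e + 1 + (d - (u - q))) q (q + d) (u + e) u"
    by (rule triple_geI; use h in \<open>smt (z3)\<close>)
  ultimately show ?thesis
    by (rule two_channelsI_distinct[rotated]) (use h in auto)
qed

text \<open>The target is the conjugate of \<open>(i,j)\<close>, and the reflected difference is
  \<open>(d, 2 * d)\<close>. Adding the first simple root to it needs the level bound
  \<open>2 * q + d + 1 \<le> a + b + c\<close>.\<close>

lemma opposite_near3:
  fixes a b c q d u e :: int
  assumes "0 \<le> b" "b \<le> a" "a \<le> c" "0 < a" "q \<le> u" "0 < d" "u = q" "e = d" "2 * q + d < a + b + c"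
    and d: "boundary a b c q d" and e: "boundary a b c u e"
  shows "two_channels a b c q (q + d) (u + e) u"
proof -
  note h = assms(1-9) boundaryD[OF d] boundaryD[OF e]
  have "adj_ge a b c 1 d (d + d)"
    by (rule adj_geI; use h in \<open>smt (z3)\<close>)
  moreover have "triple_ge (a + b + c) 1 d (d + d) q (q + d) (u + e) u"
    by (rule triple_geI; use h in \<open>smt (z3)\<close>)
  moreover have "adj_ge a b c 1 (d + 1) (d + 1 + (d - 1))"
    by (rule adj_geI; use h in \<open>smt (z3)\<close>)
  moreover have "triple_ge (a + b + c) 1 (d + 1) (d + 1 + (d - 1)) q (q + d) (u + e) u"
    by (rule triple_geI; use h in \<open>smt (z3)\<close>)
  ultimately show ?thesis
    by (rule two_channelsI_distinct[rotated]) (use h in auto)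
qed

text \<open>Here \<open>2 * q + d = a + b + c\<close>, so the highest root is added instead of the
  first simple root.\<close>

lemma opposite_near4:
  fixes a b c q d u e :: int
  assumes "0 \<le> b" "b \<le> a" "a \<le> c" "0 < a" "q \<le> u" "0 < d" "u = q" "e = d" "a + b + c \<le> 2 * q + d"
    and d: "boundary a b c q d" and e: "boundary a b c u e"
  shows "two_channels a b c q (q + d) (u + e) u"
proof -
  note h = assms(1-9) boundaryD[OF d] boundaryD[OF e]
  have "adj_ge a b c 1 d (d + d)"
    by (rule adj_geI; use h in \<open>smt (z3)\<close>)
  moreover have "triple_ge (a + b + c) 1 d (d + d) q (q + d) (u + e) u"
    by (rule triple_geI; use h in \<open>smt (z3)\<close>)
  moreover have "adj_ge a b c 1 (d + 1) (d + 1 + d)"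
    by (rule adj_geI; use h in \<open>smt (z3)\<close>)
  moreover have "triple_ge (a + b + c) 1 (d + 1) (d + 1 + d) q (q + d) (u + e) u"
    by (rule triple_geI; use h in \<open>smt (z3)\<close>)
  ultimately show ?thesis
    by (rule two_channelsI_distinct[rotated]) (use h in auto)
qed

section \<open>Combining the regions\<close>

lemma two_channels_same:
  fixes a b c q d u e :: int
  assumes "0 \<le> b" "b \<le> a" "a \<le> c" "0 < a" "q \<le> u"
    and "boundary a b c q d" "boundary a b c u e"
  shows "two_channels a b c q (q + d) u (u + e)"
proof -
  consider "d \<le> e" "2 * u - q + e + d < a + b + c" | "d \<le> e" "a + b + c \<le> 2 * u - q + e + d"
    | "e < d" "d - e \<le> u - q" | "e < d" "u - q < d - e" "d - e < 2 * (u - q)"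
    | "e < d" "2 * (u - q) \<le> d - e"
    by linarith
  then show ?thesis
    using assms by cases (blast intro: same_up_distinct same_up_double same_down_near
      same_down_far1 same_down_far2)+
qed

lemma two_channels_opposite:
  fixes a b c q d u e :: int
  assumes "0 \<le> b" "b \<le> a" "a \<le> c" "0 < a" "q \<le> u" "0 < d" "0 < e"
    and d: "boundary a b c q d" and e: "boundary a b c u e"
  shows "two_channels a b c q (q + d) (u + e) u"
proof (cases "u = q")
  case True
  \<comment> \<open>\<open>boundary\<close> fixes its last argument as a minimum depending only on
    \<open>q\<close>.\<close>
  then have "e = d"
    using boundaryD[OF d] boundaryD[OF e] by (smt (z3))
  then show ?thesis
    using True assms opposite_near3[of b a c q u d e] opposite_near4[of b a c q u d e] by linarith
next
  case False
  then consider "e + 2 * d < u - q"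
    | "d < u - q" "u - q \<le> e + 2 * d" "u - q < d + e"
    | "d < u - q" "u - q \<le> e + 2 * d" "d + e \<le> u - q"
    | "u - q \<le> d" "d < 2 * (u - q) + e"
    | "q < u" "2 * (u - q) + e \<le> d"
    using \<open>q \<le> u\<close> by linarith
  then show ?thesis
    using assms by cases (blast intro: opposite_far opposite_middle1 opposite_middle2
      opposite_near1 opposite_near2)+
qed

section \<open>Conjugation, duality and permutations of \<open>a\<close>, \<open>b\<close>,
  \<open>c\<close>\<close>

lemma adj_ge_conj: "adj_ge a b c t x y \<longleftrightarrow> adj_ge a b c t y x"
  by (simp add: adj_ge_def min.commute abs_minus_commute)

lemma triple_ge_conj:
  "triple_ge k t x y x' y' x'' y'' \<longleftrightarrow> triple_ge k t y x y' x' y'' x''"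
  unfolding triple_ge_def by (simp only: insert_commute ball_simps add.commute)

text \<open>Duality: the multiplicity of \<nu> in \<lambda> \<times> \<mu> is that of \<mu> in the
  product of \<nu> with the conjugate of \<lambda>.\<close>

lemma triple_ge_swap:
  "triple_ge k t x y x' y' x'' y'' \<longleftrightarrow> triple_ge k t y x x'' y'' x' y'"
  unfolding triple_ge_def ball_simps by (smt (z3))

lemma two_channels_conj:
  "two_channels a b c x' y' x'' y'' \<Longrightarrow> two_channels a b c y' x' y'' x''"
  unfolding two_channels_def using adj_ge_conj triple_ge_conj by (metis prod.inject)

text \<open>Each channel is replaced by its conjugate, which occurs equally often because
  \<open>(a,b) \<times> (b,a)\<close> is self-conjugate.\<close>

lemma two_channels_swap:
  "two_channels a b c x' y' x'' y'' \<Longrightarrow> two_channels a b c x'' y'' x' y'"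
  unfolding two_channels_def using adj_ge_conj triple_ge_swap by (metis prod.inject)

lemma two_channels_boundary:
  fixes a b c x y z w :: int
  assumes abc: "0 \<le> b" "b \<le> a" "a \<le> c" "0 < a"
    and X: "boundary a b c (min x y) \<bar>x - y\<bar>" and Z: "boundary a b c (min z w) \<bar>z - w\<bar>"
  shows "two_channels a b c x y z w"
proof -
  have up: "two_channels a b c x y z w"
    if xy: "x \<le> y" and "x \<le> min z w" "boundary a b c x (y - x)" "boundary a b c (min z w) \<bar>z - w\<bar>"
    for x y z w :: int
  proof -
    consider "z \<le> w" | "w < z" "x = y" | "w < z" "x < y"
      using xy by linarith
    then show ?thesis
    proof cases
      case 1
      then show ?thesis
        using two_channels_same[OF abc, of x z "y - x" "w - z"] that by simp
    next
      case 2
      \<comment> \<open>A weight with \<open>x = y\<close> is self-conjugate, so conjugation brings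
        both weights to the same side.\<close>
      then have "two_channels a b c y x w z"
        using two_channels_same[OF abc, of x w "y - x" "z - w"] that by simp
      then show ?thesis
        by (rule two_channels_conj)
    next
      case 3
      then show ?thesis
        using two_channels_opposite[OF abc, of x w "y - x" "z - w"] that by simp
    qed
  qed
  have le: "two_channels a b c x y z w"
    if "min x y \<le> min z w" "boundary a b c (min x y) \<bar>x - y\<bar>" "boundary a b c (min z w) \<bar>z - w\<bar>"
    for x y z w :: int
  proof (cases "x \<le> y")
    case True
    then show ?thesis
      using up[of x y z w] that by (simp add: min_def)
  next
    case False
    then have "two_channels a b c y x w z"
      using up[of y x w z] that by (simp add: min.commute abs_minus_commute)
    then show ?thesis
      by (rule two_channels_conj)
  qed
  show ?thesis
    using le[of x y z w] le[of z w x y] two_channels_swap X Z by (meson linear)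
qed

text \<open>A form of \<open>boundary\<close> that assumes no ordering of \<open>a\<close>,
  \<open>b\<close>, \<open>c\<close> and is therefore invariant under permuting them. The last
  conjunct excludes \<open>(k,0)\<close> and \<open>(0,k)\<close>, where
  \<open>\<bar>x - y\<bar> = min x y\<close> and \<open>x + y = k\<close>.\<close>

definition shell :: "int \<Rightarrow> int \<Rightarrow> int \<Rightarrow> int \<Rightarrow> int \<Rightarrow> bool" where
  "shell a b c x y \<longleftrightarrow> adj_ge a b c 1 x y \<and> \<not> adj_ge a b c 2 x y \<and>
     0 < min x y \<and> (\<bar>x - y\<bar> < min x y \<or> x + y < a + b + c)"

lemma shell_boundary:
  assumes "0 \<le> b" "b \<le> a" "a \<le> c" "shell a b c x y"
  shows "boundary a b c (min x y) \<bar>x - y\<bar>"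
proof -
  have "x + y = 2 * min x y + \<bar>x - y\<bar>"
    by linarith
  then show ?thesis
    using assms unfolding shell_def boundary_def adj_ge_def ball_simps by (smt (z3))
qed

text \<open>\<open>c\<close> is the zeroth affine Dynkin label of \<open>(a,b)\<close>; simple
  currents and conjugation permute the three labels and preserve
  \<open>(a,b) \<times> (b,a)\<close>. Positive pairwise sums make the middle label positive after
  sorting.\<close>

lemma two_channels_shell:
  fixes a b c x y z w :: int
  assumes "0 \<le> a" "0 \<le> b" "0 \<le> c" "0 < a + b" "0 < a + c" "0 < b + c"
    and "shell a b c x y" "shell a b c z w"
  shows "two_channels a b c x y z w"
proof -
  have "adj_ge a b c = adj_ge b a c" "adj_ge a b c = adj_ge a c b" for a b c
    by (simp_all add: adj_ge_def fun_eq_iff ac_simps conj_ac)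
  then have comm:
    "shell a b c = shell b a c" "shell a b c = shell a c b"
    "two_channels a b c = two_channels b a c" "two_channels a b c = two_channels a c b" for a b c
    unfolding shell_def two_channels_def fun_eq_iff by (simp_all add: ac_simps)
  have sorted: "two_channels a b c x y z w"
    if "0 \<le> b" "b \<le> a" "a \<le> c" "0 < a" "shell a b c x y" "shell a b c z w" for a b c
    using that by (intro two_channels_boundary shell_boundary)
  consider "b \<le> a" "a \<le> c" | "a \<le> b" "b \<le> c" | "b \<le> c" "c \<le> a" | "c \<le> b" "b \<le> a"
    | "a \<le> c" "c \<le> b" | "c \<le> a" "a \<le> b"
    by linarith
  then show ?thesis
  proof cases
    case 1
    then show ?thesis using assms sorted[of b a c] by auto
  next
    case 2
    then show ?thesis using assms sorted[of a b c] comm by (metis add.commute add_le_same_cancel1 not_le order_antisym_conv)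
  next
    case 3
    then show ?thesis using assms sorted[of b c a] comm by auto
  next
    case 4
    then show ?thesis using assms sorted[of c b a] comm by auto
  next
    case 5
    then show ?thesis using assms sorted[of a c b] comm by auto
  next
    case 6
    then show ?thesis using assms sorted[of c a b] comm by auto
  qed
qed

section \<open>Translation between Dynkin labels and root coordinates\<close>

lemma root_wt_simps:
  assumes "y \<le> 2 * x" "x \<le> 2 * y"
  shows "int (fst (root_wt x y)) = 2 * x - y" "int (snd (root_wt x y)) = 2 * y - x"
  using assms by (simp_all add: root_wt_def)

lemma fusionN_root_wt:
  assumes "t \<ge> 1" "y \<le> 2 * x" "x \<le> 2 * y" "y' \<le> 2 * x'" "x' \<le> 2 * y'" "y'' \<le> 2 * x''" "x'' \<le> 2 * y''"
  shows "t \<le> fusionN k (root_wt x y) (root_wt x' y') (root_wt x'' y'') \<longleftrightarrow>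
    triple_ge (int k) (int t) x y x' y' x'' y''"
proof -
  note [simp] = root_wt_simps[OF assms(2,3)] root_wt_simps[OF assms(4,5)] root_wt_simps[OF assms(6,7)]
  show ?thesis
    by (subst fusionN_ge_iff[where A = "x + x' + y''" and B = "y + y' + x''"])
      (use assms in \<open>auto simp: triple_ge_def algebra_simps\<close>)
qed

text \<open>After subtracting \<open>a + b\<close>, the quantities \<open>calA\<close> and
  \<open>calB\<close> become \<open>y\<close> and \<open>x\<close>; the pairs of bounds then reduce
  to those of \<open>adj_ge\<close>.\<close>

lemma fusionN_adj:
  assumes "t \<ge> 1" "a + b + c = k" "y \<le> 2 * x" "x \<le> 2 * y"
  shows "t \<le> fusionN k (a, b) (b, a) (root_wt x y) \<longleftrightarrow>
    adj_ge (int a) (int b) (int c) (int t) x y"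
proof -
  note [simp] = root_wt_simps[OF assms(3,4)]
  have k: "int k = int a + int b + int c"
    using assms(2) by simp
  show ?thesis
  proof (subst fusionN_ge_iff[where A = "int a + int b + y" and B = "int a + int b + x"], goal_cases)
    case 4
    show ?case
      using assms(1) unfolding adj_ge_def ball_simps k fst_conv snd_conv root_wt_simps[OF assms(3,4)] of_nat_add
      by (smt (z3))
  qed (use assms in auto)
qed

text \<open>The bounds \<open>min x y\<close> and \<open>a + b + c - 2 * min x y\<close> on
  \<open>\<bar>x - y\<bar>\<close> give dominance and the level condition, so channels lie in
  \<open>Pplus k\<close>.\<close>

lemma adj_ge_dominant:
  assumes "adj_ge a b c t x y" "t \<ge> 1"
  shows "y \<le> 2 * x" "x \<le> 2 * y" "x + y \<le> a + b + c"
  using assms unfolding adj_ge_def ball_simps by linarith+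

lemma R1_root_wt:
  assumes "(i, j) \<in> R1 k (a, b) (b, a)"
  obtains x y where "(i, j) = root_wt x y" "y \<le> 2 * x" "x \<le> 2 * y"
proof -
  have "fusionN k (a, b) (b, a) (i, j) = 1"
    using assms by (simp add: R1_def)
  then have "calA (a, b) (b, a) (i, j) \<in> \<nat>"
    by (auto simp: fusionN_def split: if_splits)
  then obtain A where "calA (a, b) (b, a) (i, j) = of_nat A"
    by (elim Nats_cases)
  then have "rat_of_nat (2 * (a + b + j) + (b + a + i)) = rat_of_nat (3 * A)"
    by (simp add: calA_def field_simps)
  then have "2 * (a + b + j) + (b + a + i) = 3 * A"
    by (simp only: of_nat_eq_iff)
  then have "int i + 2 * int j = 3 * (int A - int a - int b)"
    by simp
  then show ?thesis
    \<comment> \<open>Solved from \<open>calA = a + b + y\<close> and \<open>x + y = i + j\<close>;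
      integrality of \<open>calA\<close> puts \<open>(i,j)\<close> in the root lattice.\<close>
    by (intro that[of "int i + int j - (int A - int a - int b)" "int A - int a - int b"])
      (auto simp: root_wt_def)
qed

lemma R1_shell:
  assumes "(i, j) \<in> R1 k (a, b) (b, a)" "(i, j) \<notin> simple_currents k"
    and k: "a + b + c = k" and ij: "(i, j) = root_wt x y" and dom: "y \<le> 2 * x" "x \<le> 2 * y"
  shows "shell (int a) (int b) (int c) x y"
proof -
  have N: "fusionN k (a, b) (b, a) (root_wt x y) = 1" and le: "i + j \<le> k"
    using assms(1) unfolding ij[symmetric] by (auto simp: R1_def Pplus_def)
  have adj: "adj_ge (int a) (int b) (int c) 1 x y" "\<not> adj_ge (int a) (int b) (int c) 2 x y"
    using fusionN_adj[of 1 a b c k y x] fusionN_adj[of 2 a b c k y x] N k dom by auto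
  have i: "int i = 2 * x - y" and j: "int j = 2 * y - x"
    using root_wt_simps[OF dom] ij[symmetric] by auto
  have "(i, j) \<noteq> (0, 0)" "(i, j) \<noteq> (k, 0)" "(i, j) \<noteq> (0, k)"
    using assms(2) by (auto simp: simple_currents_def)
  then have "i + j \<noteq> 0" "i + j < k \<or> (0 < i \<and> 0 < j)"
    using le by auto
  then have "x + y \<noteq> 0" "x + y < int k \<or> (y < 2 * x \<and> x < 2 * y)"
    using i j by linarith+
  then show ?thesis
    using adj dom k unfolding shell_def by auto
qed

lemma root_wt_inj:
  assumes "root_wt x y = root_wt z w" "y \<le> 2 * x" "x \<le> 2 * y" "w \<le> 2 * z" "z \<le> 2 * w"
  shows "x = z" "y = w"
  using root_wt_simps[OF assms(2,3)] root_wt_simps[OF assms(4,5)] assms(1) by auto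

section \<open>Summing the channels\<close>

theorem theorem4p2:
  fixes k a b i j m n :: nat
  assumes "k \<ge> 1"
    and "(a, b) \<in> Pplus k" and "(a, b) \<notin> simple_currents k"
    and "(i, j) \<in> R1 k (a, b) (b, a)" and "(m, n) \<in> R1 k (a, b) (b, a)"
    and "(i, j) \<notin> simple_currents k" and "(m, n) \<notin> simple_currents k"
  shows "dimHom0 k [(a, b), (b, a), (i, j), (m, n)] > 1"
proof -
  define c where "c = k - (a + b)"
  have k: "a + b + c = k" and ba: "(b, a) \<in> Pplus k"
    using assms(2) by (auto simp: c_def Pplus_def)
  obtain x y where X: "(i, j) = root_wt x y" "y \<le> 2 * x" "x \<le> 2 * y"
    using R1_root_wt[OF assms(4)] .
  obtain z w where Z: "(m, n) = root_wt z w" "w \<le> 2 * z" "z \<le> 2 * w"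
    using R1_root_wt[OF assms(5)] .
  have conj: "conj_wt (m, n) = root_wt w z"
    using Z by (simp add: conj_wt_def root_wt_def)
  have "shell (int a) (int b) (int c) x y" "shell (int a) (int b) (int c) z w"
    using R1_shell[OF assms(4,6) k X] R1_shell[OF assms(5,7) k Z] .
  \<comment> \<open>The target is the conjugate of \<open>(m,n)\<close>, so its coordinates are
    exchanged.\<close>
  then have shells: "shell (int a) (int b) (int c) x y" "shell (int a) (int b) (int c) w z"
    by (auto simp: shell_def min.commute abs_minus_commute add.commute adj_ge_conj)
  \<comment> \<open>Two vanishing affine labels would make \<open>(a,b)\<close> a simple
    current.\<close>
  have "0 < a + b" "0 < a + c" "0 < b + c"
    using assms(3) k by (auto simp: simple_currents_def)
  then have two: "two_channels (int a) (int b) (int c) x y w z"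
    using shells by (intro two_channels_shell) auto
  let ?N = "\<lambda>v. int (fusionN k (a, b) (b, a) v) * int (fusionN k v (i, j) (conj_wt (m, n)))"
  have dim: "sum ?N T \<le> dimHom0 k [(a, b), (b, a), (i, j), (m, n)]" if "T \<subseteq> Pplus k" for T
    using assms that ba by (intro dimHom0_ge) (auto simp: R1_def)
  have channel: "root_wt p q \<in> Pplus k" "int t \<le> ?N (root_wt p q)"
    if adj: "adj_ge (int a) (int b) (int c) (int t) p q" and t: "t \<ge> 1"
      and tri: "triple_ge (int a + int b + int c) 1 p q x y w z" for p q t
  proof -
    have pq: "q \<le> 2 * p" "p \<le> 2 * q" "p + q \<le> int k"
      using adj_ge_dominant[OF adj] t k by auto
    show "root_wt p q \<in> Pplus k"
      using pq by (auto simp: root_wt_def Pplus_def)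
    have "t \<le> fusionN k (a, b) (b, a) (root_wt p q)"
      using adj t pq k by (subst fusionN_adj[where c = c]) auto
    moreover have "1 \<le> fusionN k (root_wt p q) (i, j) (conj_wt (m, n))"
      unfolding conj X using tri pq X Z k by (subst fusionN_root_wt) auto
    ultimately have "t * 1 \<le> fusionN k (a, b) (b, a) (root_wt p q) * fusionN k (root_wt p q) (i, j) (conj_wt (m, n))"
      by (rule mult_le_mono)
    then show "int t \<le> ?N (root_wt p q)"
      by (simp flip: of_nat_mult)
  qed
  from two consider
    p q where "adj_ge (int a) (int b) (int c) 2 p q" "triple_ge (int a + int b + int c) 1 p q x y w z"
    | p q r s where "(p, q) \<noteq> (r, s)"
      "adj_ge (int a) (int b) (int c) 1 p q" "triple_ge (int a + int b + int c) 1 p q x y w z"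
      "adj_ge (int a) (int b) (int c) 1 r s" "triple_ge (int a + int b + int c) 1 r s x y w z"
    unfolding two_channels_def by blast
  then show ?thesis
  proof cases
    case 1
    then show ?thesis
      using channel[of 2 p q] dim[of "{root_wt p q}"] by simp
  next
    case 2
    \<comment> \<open>Injectivity of \<open>root_wt\<close> relies on dominance, since
      \<open>nat\<close> truncates.\<close>
    then have "root_wt p q \<noteq> root_wt r s"
      using root_wt_inj[of p q r s] adj_ge_dominant[OF 2(2)] adj_ge_dominant[OF 2(4)] by auto
    then show ?thesis
      using 2 channel[of 1 p q] channel[of 1 r s] dim[of "{root_wt p q, root_wt r s}"] by simp
  qed
qed

end
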